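(* Let $1<p,q<\infty$. Let $\mu$ be a finite Borel measure on $G$ and let $\nu$ be a Borel measure on $\widehat{G}$ which is a $(p,q)$-frame measure for $\mu$ with frame bounds $A,B>0$. Assume in addition that there exist a Borel set $F\subset G$ with $\mu(F)>0$ and $a\in G$ such that $T_a(\mu|_{F+a})\ll\mu$. Then $$\left\|\frac{dT_a(\mu|_{F+a})}{d\mu}\right\|_\infty^{q(1-\frac1p)}\le\frac{B}{A}.$$
   Context: $G$ is a locally compact Hausdorff abelian (LCA) group, written additively, which is metrizable and a countable union of compact sets; $\widehat{G}$ is its dual group (continuous characters), and $\langle x,\gamma\rangle$ denotes the value of $\gamma\in\widehat{G}$ at $x\in G$. Measures are non-negative. For a Borel measure $\mu$ on $G$, a Borel set $E\subset G$ and $a\in G$: $\mu|_E(F)=\mu(E\cap F)$ and $T_a\mu(F)=\mu(F+a)$ for Borel $F\subset G$; thus $\int_G f\,dT_a(\mu|_E)=\int_E f(x-a)\,d\mu(x)$. $\ll$ denotes absolute continuity, $\frac{d\cdot}{d\mu}$ the Radon–Nikodym derivative, and $\|\cdot\|_\infty$ the $\mu$-essential supremum norm. For a finite Borel measure $\mu$ on $G$ and $f\in L^1(\mu)$, $\widehat{fd\mu}(\gamma)=\int_G f(x)\overline{\langle x,\gamma\rangle}\,d\mu(x)$ for $\gamma\in\widehat{G}$. A Borel measure $\nu$ on $\widehat{G}$ is a $(p,q)$-frame measure for $\mu$ with frame bounds $A,B$ if $0<A\le B<\infty$ and $A\|f\|_{L^p(\mu)}^q\le\|\widehat{fd\mu}\|_{L^q(\nu)}^q\le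 B\|f\|_{L^p(\mu)}^q$ for all $f\in L^p(\mu)$. *)

theory Defs
  imports "HOL-Probability.Probability"
begin

section \<open>The dual group\<close>

definition dual_group :: "('a::topological_ab_group_add \<Rightarrow> complex) set" where
  "dual_group = {\<gamma>. continuous_on UNIV \<gamma> \<and> (\<forall>x. cmod (\<gamma> x) = 1) \<and>
                     (\<forall>x y. \<gamma> (x + y) = \<gamma> x * \<gamma> y)}"

text \<open>The compact-open topology, which on the dual group is the topology of uniform convergence
  on compact sets.\<close>

definition dual_topology :: "('a::topological_ab_group_add \<Rightarrow> complex) topology" where
  "dual_topology = topology_generated_by
     {{\<gamma> \<in> dual_group. \<gamma> ` K \<subseteq> U} | K U. compact K \<and> open U}"

definition dual_borel :: "('a::topological_ab_group_add \<Rightarrow> complex) measure" where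
  "dual_borel = sigma dual_group {V. openin dual_topology V}"

lemma topspace_dual_topology: "topspace dual_topology = dual_group"
proof -
  have "dual_group \<in> {{\<gamma> \<in> dual_group. \<gamma> ` K \<subseteq> U} | K U. compact K \<and> open U}"
    by (auto intro!: exI[of _ "{}"])
  then show ?thesis
    unfolding dual_topology_def topology_generated_by_topspace by blast
qed

lemma space_dual_borel: "space dual_borel = dual_group"
  unfolding dual_borel_def by (rule space_measure_of) (metis (no_types, lifting) Pow_iff
    mem_Collect_eq openin_subset subsetI topspace_dual_topology)

lemma sets_dual_borel: "sets dual_borel = sigma_sets dual_group {V. openin dual_topology V}"
  unfolding dual_borel_def by (rule sets_measure_of) (metis (no_types, lifting) Pow_iff
    mem_Collect_eq openin_subset subsetI topspace_dual_topology)

section \<open>Restrictions and translates of measures\<close>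

definition restr_measure :: "'a measure \<Rightarrow> 'a set \<Rightarrow> 'a measure" where
  "restr_measure \<mu> E = density \<mu> (indicator E)"

definition transl_measure :: "'a::topological_ab_group_add \<Rightarrow> 'a measure \<Rightarrow> 'a measure" where
  "transl_measure a \<mu> = distr \<mu> borel (\<lambda>x. x - a)"

lemma emeasure_restr_measure:
  assumes "E \<in> sets \<mu>" and "F \<in> sets \<mu>"
  shows "emeasure (restr_measure \<mu> E) F = emeasure \<mu> (E \<inter> F)"
  using assms unfolding restr_measure_def
  by (simp add: emeasure_density flip: indicator_inter_arith)

lemma emeasure_transl_measure:
  assumes "sets \<mu> = sets borel" and "F \<in> sets borel"
  shows "emeasure (transl_measure a \<mu>) F = emeasure \<mu> ((\<lambda>x. x + a) ` F)"
proof -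
  have "(\<lambda>x. x - a) \<in> borel \<rightarrow>\<^sub>M borel"
    by (intro borel_measurable_continuous_onI continuous_intros)
  then have m: "(\<lambda>x. x - a) \<in> \<mu> \<rightarrow>\<^sub>M borel"
    using assms(1) by (simp cong: measurable_cong_sets)
  have "space \<mu> = UNIV"
    using sets_eq_imp_space_eq[OF assms(1)] by simp
  moreover have "(\<lambda>x. x - a) -` F = (\<lambda>x. x + a) ` F"
    by (auto simp: image_iff intro!: bexI[of _ "_ - a"])
  ultimately show ?thesis
    unfolding transl_measure_def using emeasure_distr[OF m assms(2)] by simp
qed

section \<open>Frame measures\<close>

text \<open>Powers with a positive real exponent in the extended half-line; only used for r > 0.\<close>

definition enn_powr :: "ennreal \<Rightarrow> real \<Rightarrow> ennreal" where
  "enn_powr x r = (if x = \<infinity> then \<infinity> else ennreal (enn2real x powr r))"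

definition Lp_norm :: "real \<Rightarrow> 'a measure \<Rightarrow> ('a \<Rightarrow> complex) \<Rightarrow> ennreal" where
  "Lp_norm p M f = enn_powr (\<integral>\<^sup>+ x. ennreal (cmod (f x) powr p) \<partial>M) (1 / p)"

definition Lp_space :: "real \<Rightarrow> 'a measure \<Rightarrow> ('a \<Rightarrow> complex) set" where
  "Lp_space p M = {f \<in> borel_measurable M. Lp_norm p M f < \<infinity>}"

definition fourier_transform :: "'a measure \<Rightarrow> ('a \<Rightarrow> complex) \<Rightarrow> ('a \<Rightarrow> complex) \<Rightarrow> complex" where
  "fourier_transform \<mu> f \<gamma> = (\<integral>x. f x * cnj (\<gamma> x) \<partial>\<mu>)"

definition frame_measure ::
    "real \<Rightarrow> real \<Rightarrow> 'a measure \<Rightarrow> ('a \<Rightarrow> complex) measure \<Rightarrow> real \<Rightarrow> real \<Rightarrow> bool" where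
  "frame_measure p q \<mu> \<nu> A B \<longleftrightarrow> 0 < A \<and> A \<le> B \<and>
     (\<forall>f \<in> Lp_space p \<mu>.
        ennreal A * enn_powr (Lp_norm p \<mu> f) q \<le> enn_powr (Lp_norm q \<nu> (fourier_transform \<mu> f)) q \<and>
        enn_powr (Lp_norm q \<nu> (fourier_transform \<mu> f)) q \<le> ennreal B * enn_powr (Lp_norm p \<mu> f) q)"

end

theory Submission
  imports Defs
begin

text \<open>Let h be the density of the translated measure. Translation only multiplies a Fourier
  transform by a unimodular factor, so for a Borel set E with indicator f, the functions \<open>h x * f x\<close>
  and \<open>f (x - a)\<close>, the latter cut off to \<open>F + a\<close>, have Fourier transforms of equal modulus. The
  lower frame bound for the former and the upper one for the latter bound the integral of
  \<open>h powr p\<close> over E by a multiple of that of h; testing this on \<open>E = {x. t < h x \<le> n}\<close> bounds t.\<close>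

section \<open>Powers and norms with finite values\<close>

lemma enn_powr_ennreal: "0 \<le> x \<Longrightarrow> enn_powr (ennreal x) r = ennreal (x powr r)"
  by (simp add: enn_powr_def)

lemma enn_powr_ennreal_le:
  assumes "S \<le> ennreal c" "0 \<le> c" "0 \<le> r"
  shows "enn_powr S r \<le> ennreal (c powr r)"
proof -
  have "S \<noteq> \<infinity>" using assms(1) by (auto simp: top_unique)
  then show ?thesis
    using assms unfolding enn_powr_def
    by (auto intro!: ennreal_leI powr_mono2 enn2real_leI)
qed

text \<open>The exponents \<open>1 / p\<close> and \<open>q\<close> compose to \<open>q / p\<close>,
  which turns each side of a frame inequality into a power of a real integral.\<close>

lemma Lp_norm_powr:
  assumes "(\<integral>\<^sup>+x. ennreal (cmod (f x) powr p) \<partial>M) = ennreal I" "0 \<le> I"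
  shows "enn_powr (Lp_norm p M f) q = ennreal (I powr (q / p))"
  using assms by (simp add: Lp_norm_def enn_powr_ennreal powr_powr)

lemma Lp_spaceI:
  assumes "f \<in> borel_measurable M" "(\<integral>\<^sup>+x. ennreal (cmod (f x) powr p) \<partial>M) = ennreal I" "0 \<le> I"
  shows "f \<in> Lp_space p M"
  using assms by (simp add: Lp_space_def Lp_norm_def enn_powr_ennreal)

text \<open>Only the modulus enters the norm, so the unimodular factor that a translation produces
  is invisible to it.\<close>

lemma Lp_norm_fourier_cong:
  assumes "\<And>\<gamma>. \<gamma> \<in> space \<nu> \<Longrightarrow> cmod (fourier_transform \<mu> f \<gamma>) = cmod (fourier_transform \<mu> g \<gamma>)"
  shows "Lp_norm q \<nu> (fourier_transform \<mu> f) = Lp_norm q \<nu> (fourier_transform \<mu> g)"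
  unfolding Lp_norm_def using assms by (intro arg_cong2[where f = enn_powr] nn_integral_cong) auto

section \<open>Fourier transforms of translated and weighted measures\<close>

lemma borel_measurable_diff_const:
  fixes a :: "'a::topological_ab_group_add"
  shows "(\<lambda>x. x - a) \<in> borel \<rightarrow>\<^sub>M borel"
  by (intro borel_measurable_continuous_onI continuous_intros)

lemma borel_measurable_cnj[measurable]: "cnj \<in> borel \<rightarrow>\<^sub>M borel"
  by (intro borel_measurable_continuous_onI continuous_intros)

lemma dual_group_measurable: "\<gamma> \<in> dual_group \<Longrightarrow> \<gamma> \<in> borel_measurable borel"
  unfolding dual_group_def by (auto intro: borel_measurable_continuous_onI)

lemma translate_borel:
  fixes a :: "'a::topological_ab_group_add"
  assumes "F \<in> sets borel"
  shows "(\<lambda>x. x + a) ` F \<in> sets borel"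
proof -
  have "(\<lambda>x. x + a) ` F = (\<lambda>x. x - a) -` F"
    by (auto simp: image_iff intro!: bexI[of _ "_ - a"])
  then show ?thesis
    using measurable_sets[OF borel_measurable_diff_const assms, of a] by simp
qed

text \<open>Substituting \<open>x - a\<close> for the variable splits the character as
  \<open>\<gamma> x * \<gamma> (- a)\<close>; the second factor is constant of modulus 1 and leaves
  the integral.\<close>

lemma fourier_transform_translate:
  fixes \<mu> :: "'a::topological_ab_group_add measure"
  assumes \<mu>: "sets \<mu> = sets borel" and F: "F \<in> sets borel"
    and f: "f \<in> borel_measurable borel" and \<gamma>: "\<gamma> \<in> dual_group"
  shows "cmod (fourier_transform (transl_measure a (restr_measure \<mu> ((\<lambda>x. x + a) ` F))) f \<gamma>)
    = cmod (fourier_transform \<mu> (\<lambda>x. indicator ((\<lambda>x. x + a) ` F) x *\<^sub>R f (x - a)) \<gamma>)"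
proof -
  let ?G = "(\<lambda>x. x + a) ` F"
  note [measurable_cong] = \<mu>
  note [measurable] = f dual_group_measurable[OF \<gamma>] borel_measurable_diff_const
    translate_borel[OF F, of a]
  have split: "\<gamma> (x - a) = \<gamma> x * \<gamma> (- a)" for x
    using \<gamma> unfolding dual_group_def
    by (metis (mono_tags, lifting) mem_Collect_eq diff_conv_add_uminus)
  \<comment> \<open>\<open>integral_density\<close> expects a real density wrapped in
    \<open>ennreal\<close>, whereas \<open>restr_measure\<close> uses the indicator with values in
    \<open>ennreal\<close>.\<close>
  have restr: "restr_measure \<mu> ?G = density \<mu> (\<lambda>x. ennreal (indicator ?G x))"
    unfolding restr_measure_def
    by (intro arg_cong2[where f = density] ext) (auto simp: indicator_def)
  have unit: "cmod (\<gamma> (- a)) = 1"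
    using \<gamma> by (simp add: dual_group_def)
  have "fourier_transform (transl_measure a (restr_measure \<mu> ?G)) f \<gamma>
      = (\<integral>x. f (x - a) * cnj (\<gamma> (x - a)) \<partial>restr_measure \<mu> ?G)"
    unfolding fourier_transform_def transl_measure_def
    by (subst integral_distr) (simp_all add: restr_measure_def)
  also have "\<dots> = (\<integral>x. indicator ?G x *\<^sub>R (f (x - a) * cnj (\<gamma> (x - a))) \<partial>\<mu>)"
    unfolding restr by (subst integral_density) simp_all
  also have "\<dots> = (\<integral>x. cnj (\<gamma> (- a)) * ((indicator ?G x *\<^sub>R f (x - a)) * cnj (\<gamma> x)) \<partial>\<mu>)"
    by (intro Bochner_Integration.integral_cong) (auto simp: split algebra_simps)
  also have "\<dots> = cnj (\<gamma> (- a)) *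
      fourier_transform \<mu> (\<lambda>x. indicator ?G x *\<^sub>R f (x - a)) \<gamma>"
    \<comment> \<open>Integrability is not at issue: a non-integrable function has Bochner integral
      0, which respects constant factors.\<close>
    unfolding fourier_transform_def by (rule integral_mult_right_zero)
  finally show ?thesis
    by (simp add: norm_mult unit)
qed

lemma fourier_transform_density:
  assumes "h \<in> borel_measurable \<mu>" "\<And>x. 0 \<le> h x"
    and "f \<in> borel_measurable \<mu>" "\<gamma> \<in> borel_measurable \<mu>"
  shows "fourier_transform (density \<mu> (\<lambda>x. ennreal (h x))) f \<gamma>
    = fourier_transform \<mu> (\<lambda>x. h x *\<^sub>R f x) \<gamma>"
proof -
  note [measurable] = assms(1,3,4)
  show ?thesis
    unfolding fourier_transform_def using assms(2) by (subst integral_density) simp_all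
qed

section \<open>The bound for a single level of the density\<close>

text \<open>With \<open>m\<close> and \<open>I\<close> the integrals of \<open>h\<close> and of
  \<open>h powr p\<close> over a test set inside \<open>{x. t < h x}\<close>, the frame bounds give
  \<open>A * I powr (q / p) \<le> B * m powr (q / p)\<close>, while
  \<open>t powr (p - 1) * m \<le> I\<close>. Cancelling \<open>m\<close> leaves the claim.\<close>

lemma frame_measure_level_bound:
  fixes \<mu> :: "'a::topological_ab_group_add measure"
    and h :: "'a \<Rightarrow> real"
  assumes "1 < p" "1 < q"
    and \<mu>: "sets \<mu> = sets borel" and fin: "finite_measure \<mu>"
    and \<nu>: "sets \<nu> = sets dual_borel"
    and frame: "frame_measure p q \<mu> \<nu> A B"
    and F: "F \<in> sets borel"
    and h: "h \<in> borel_measurable \<mu>" "\<And>x. 0 \<le> h x"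
    and dens: "density \<mu> (\<lambda>x. ennreal (h x))
      = transl_measure a (restr_measure \<mu> ((\<lambda>x. x + a) ` F))"
    and t: "0 < t" and pos: "emeasure \<mu> {x. t < h x} > 0"
  shows "t powr (q * (1 - 1 / p)) \<le> B / A"
proof -
  interpret finite_measure \<mu> by (rule fin)
  let ?G = "(\<lambda>x. x + a) ` F"
  let ?D = "density \<mu> (\<lambda>x. ennreal (h x))"
  have sp\<nu>: "space \<nu> = dual_group"
    using sets_eq_imp_space_eq[OF \<nu>] space_dual_borel by simp
  note [measurable_cong] = \<mu>
  have hb: "h \<in> borel_measurable borel"
    using h(1) by simp
  note [measurable] = hb borel_measurable_diff_const translate_borel[OF F, of a]
  \<comment> \<open>The cap \<open>n\<close> makes \<open>h\<close> bounded on the test set, so that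
    \<open>u\<close> below lies in the space for \<open>p\<close>; as the sets exhaust
    \<open>{x. t < h x}\<close>, one of them has positive measure.\<close>
  define E where "E n = {x. t < h x \<and> h x \<le> real n}" for n :: nat
  have E[measurable]: "E n \<in> sets borel" for n
    unfolding E_def by simp
  have "{x. t < h x} = (\<Union>n. E n)"
    unfolding E_def by (auto intro: real_arch_simple)
  with pos have "emeasure \<mu> (\<Union>n. E n) \<noteq> 0" by simp
  then obtain n where n: "emeasure \<mu> (E n) \<noteq> 0"
    using emeasure_UN_eq_0[of \<mu> E] \<mu> E by (metis image_subsetI)
  define f :: "'a \<Rightarrow> complex" where "f = indicator (E n)"
  have [measurable]: "f \<in> borel_measurable borel"
    unfolding f_def by simp
  define u where "u = (\<lambda>x. h x *\<^sub>R f x)"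
  define g where "g = (\<lambda>x. indicator ?G x *\<^sub>R f (x - a))"
  have [measurable]: "u \<in> borel_measurable borel" "g \<in> borel_measurable borel"
    unfolding u_def g_def by simp_all
  define m where "m = measure ?D (E n)"
  define I where "I = (\<integral>x. cmod (u x) powr p \<partial>\<mu>)"
  have u_bd: "cmod (u x) powr p \<le> real n powr p" for x
    using \<open>1 < p\<close> h(2)[of x] unfolding u_def f_def E_def
    by (auto simp: indicator_def intro: powr_mono2)
  have int_u: "integrable \<mu> (\<lambda>x. cmod (u x) powr p)"
    by (rule integrable_const_bound[where B = "real n powr p"]) (use u_bd in auto)
  have Iu: "(\<integral>\<^sup>+x. ennreal (cmod (u x) powr p) \<partial>\<mu>) = ennreal I"
    unfolding I_def using int_u by (intro nn_integral_eq_integral) auto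
  have I0: "0 \<le> I" unfolding I_def by simp
  have D: "emeasure ?D (E n) = (\<integral>\<^sup>+x. ennreal (h x) * indicator (E n) x \<partial>\<mu>)"
    by (simp add: emeasure_density)
  have "emeasure ?D (E n) \<le> (\<integral>\<^sup>+x. ennreal (real n) \<partial>\<mu>)"
    unfolding D by (intro nn_integral_mono) (auto simp: E_def indicator_def ennreal_leI)
  also have "\<dots> < \<infinity>"
    by (simp add: ennreal_mult_eq_top_iff emeasure_finite less_top[symmetric])
  finally have mE: "emeasure ?D (E n) = ennreal m"
    unfolding m_def by (simp add: emeasure_eq_ennreal_measure)
  \<comment> \<open>Positivity of \<open>m\<close>, which the final cancellation relies on, comes
    from \<open>h\<close> exceeding \<open>t > 0\<close> on a set of positive measure.\<close>
  have "ennreal t * emeasure \<mu> (E n) = (\<integral>\<^sup>+x. ennreal t * indicator (E n) x \<partial>\<mu>)"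
    by (simp add: nn_integral_cmult_indicator)
  also have "\<dots> \<le> emeasure ?D (E n)"
    unfolding D by (intro nn_integral_mono) (auto simp: E_def indicator_def ennreal_leI)
  finally have "ennreal m \<noteq> 0"
    unfolding mE using n t by auto
  then have m0: "0 < m" by (simp add: m_def zero_less_measure_iff)
  \<comment> \<open>\<open>g\<close> takes only the values 0 and 1, so its power integral is the
    mass that the translated measure gives to \<open>E n\<close>; by \<open>dens\<close> this is
    \<open>m\<close>.\<close>
  have Ig: "(\<integral>\<^sup>+x. ennreal (cmod (g x) powr p) \<partial>\<mu>) = ennreal m"
  proof -
    have "(\<integral>\<^sup>+x. ennreal (cmod (g x) powr p) \<partial>\<mu>)
        = (\<integral>\<^sup>+x. indicator ?G x * indicator (E n) (x - a) \<partial>\<mu>)"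
      by (intro nn_integral_cong) (auto simp: g_def f_def indicator_def)
    also have "\<dots> = (\<integral>\<^sup>+x. indicator (E n) x \<partial>transl_measure a (restr_measure \<mu> ?G))"
      unfolding transl_measure_def restr_measure_def
      by (subst nn_integral_distr) (simp_all add: nn_integral_density)
    also have "\<dots> = ennreal m"
      unfolding dens[symmetric] mE[symmetric] by simp
    finally show ?thesis .
  qed
  \<comment> \<open>Splitting off one factor \<open>h x\<close> from \<open>h x powr p\<close>
    produces the gain \<open>t powr (p - 1)\<close>, since \<open>p > 1\<close>.\<close>
  have "t powr (p - 1) * h x \<le> h x powr p" if "x \<in> E n" for x
  proof -
    have "t powr (p - 1) * h x \<le> h x powr (p - 1) * h x powr 1"
      using that t \<open>1 < p\<close> by (auto simp: E_def intro!: mult_right_mono powr_mono2)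
    also have "\<dots> = h x powr p"
      by (simp only: flip: powr_add) simp
    finally show ?thesis .
  qed
  then have "(\<integral>\<^sup>+x. ennreal (t powr (p - 1)) * (ennreal (h x) * indicator (E n) x) \<partial>\<mu>)
      \<le> (\<integral>\<^sup>+x. ennreal (cmod (u x) powr p) \<partial>\<mu>)"
    using h(2) by (intro nn_integral_mono)
      (auto simp: u_def f_def indicator_def ennreal_leI simp flip: ennreal_mult)
  then have "ennreal (t powr (p - 1)) * ennreal m \<le> ennreal I"
    unfolding Iu mE[symmetric] D by (simp add: nn_integral_cmult)
  then have tI: "t powr (p - 1) * m \<le> I"
    using I0 m0 by (simp flip: ennreal_mult)
  \<comment> \<open>Both transforms have the modulus of the transform of \<open>f\<close> against
    the translated measure, written once as a density and once as an image measure.\<close>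
  have four: "Lp_norm q \<nu> (fourier_transform \<mu> u) = Lp_norm q \<nu> (fourier_transform \<mu> g)"
  proof (rule Lp_norm_fourier_cong)
    fix \<gamma> assume "\<gamma> \<in> space \<nu>"
    then have \<gamma>: "\<gamma> \<in> dual_group" by (simp add: sp\<nu>)
    note [measurable] = dual_group_measurable[OF \<gamma>]
    show "cmod (fourier_transform \<mu> u \<gamma>) = cmod (fourier_transform \<mu> g \<gamma>)"
      using fourier_transform_density[of h \<mu> f \<gamma>] fourier_transform_translate[OF \<mu> F _ \<gamma>, of f a] h(2)
      by (simp add: u_def g_def dens)
  qed
  have A: "0 < A" "A \<le> B" using frame by (simp_all add: frame_measure_def)
  have "ennreal A * enn_powr (Lp_norm p \<mu> u) q \<le> enn_powr (Lp_norm q \<nu> (fourier_transform \<mu> u)) q"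
    using frame Lp_spaceI[OF _ Iu I0] unfolding frame_measure_def by simp
  also have "\<dots> \<le> ennreal B * enn_powr (Lp_norm p \<mu> g) q"
    unfolding four using frame Lp_spaceI[OF _ Ig] m0 unfolding frame_measure_def by simp
  finally have "A * I powr (q / p) \<le> B * m powr (q / p)"
    using A m0 I0 Lp_norm_powr[OF Iu, of q] Lp_norm_powr[OF Ig, of q]
    by (simp flip: ennreal_mult)
  moreover have "(t powr (p - 1) * m) powr (q / p) \<le> I powr (q / p)"
    using tI m0 \<open>1 < p\<close> \<open>1 < q\<close> by (intro powr_mono2) auto
  \<comment> \<open>The exponent arises as
    \<open>(p - 1) * (q / p) = q * (1 - 1 / p)\<close>.\<close>
  moreover have "(t powr (p - 1) * m) powr (q / p) = t powr (q * (1 - 1 / p)) * m powr (q / p)"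
    using m0 t \<open>1 < p\<close> by (simp add: powr_mult powr_powr field_simps)
  ultimately have "(A * t powr (q * (1 - 1 / p))) * m powr (q / p) \<le> B * m powr (q / p)"
    using A by (smt (verit) mult.assoc mult_left_mono)
  then have "A * t powr (q * (1 - 1 / p)) \<le> B"
    using m0 by simp
  then show ?thesis
    using A by (simp add: field_simps)
qed

theorem theorem2p13:
  fixes \<mu> :: "'a::{topological_ab_group_add, t2_space} measure"
    and \<nu> :: "('a \<Rightarrow> complex) measure"
    and F :: "'a set" and a :: 'a and p q A B :: real
  assumes "locally_compact_space (euclidean :: 'a topology)"
    and "metrizable_space (euclidean :: 'a topology)"
    and "\<exists>K :: nat \<Rightarrow> 'a set. (\<forall>n. compact (K n)) \<and> (\<Union>n. K n) = UNIV"
    and "1 < p" and "1 < q"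
    and "sets \<mu> = sets borel" and "finite_measure \<mu>"
    and "sets \<nu> = sets dual_borel"
    and "frame_measure p q \<mu> \<nu> A B"
    and "F \<in> sets borel" and "emeasure \<mu> F > 0"
    and "absolutely_continuous \<mu> (transl_measure a (restr_measure \<mu> ((\<lambda>x. x + a) ` F)))"
  shows "enn_powr
      (esssup \<mu> (RN_deriv \<mu> (transl_measure a (restr_measure \<mu> ((\<lambda>x. x + a) ` F)))))
      (q * (1 - 1 / p)) \<le> ennreal (B / A)"
proof -
  interpret finite_measure \<mu> by fact
  let ?L = "transl_measure a (restr_measure \<mu> ((\<lambda>x. x + a) ` F))"
  let ?h = "RN_deriv \<mu> ?L"
  define r where "r = q * (1 - 1 / p)"
  \<comment> \<open>Since \<open>c powr r = B / A\<close>, it suffices to bound the essential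
    supremum itself by \<open>c\<close>.\<close>
  define c where "c = (B / A) powr (1 / r)"
  have r: "0 < r" using \<open>1 < p\<close> \<open>1 < q\<close> by (simp add: r_def)
  have A: "0 < A" "A \<le> B"
    using \<open>frame_measure p q \<mu> \<nu> A B\<close> by (simp_all add: frame_measure_def)
  have c: "0 \<le> c" "c powr r = B / A"
    using r A by (simp_all add: c_def powr_powr)
  have sp: "space \<mu> = UNIV"
    using sets_eq_imp_space_eq[OF \<open>sets \<mu> = sets borel\<close>] by simp
  have setsL: "sets ?L = sets \<mu>"
    by (simp add: transl_measure_def \<open>sets \<mu> = sets borel\<close>)
  have dens: "density \<mu> ?h = ?L"
    by (rule density_RN_deriv) (use assms setsL in auto)
  \<comment> \<open>Finiteness of the translated measure makes its density finite almost everywhere,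
    so \<open>enn2real\<close>, which sends infinity to 0, alters it only on a null set.\<close>
  have "finite_measure ?L"
  proof
    have G: "(\<lambda>x. x + a) ` F \<in> sets \<mu>"
      using translate_borel[OF \<open>F \<in> sets borel\<close>] \<open>sets \<mu> = sets borel\<close> by simp
    have "emeasure ?L UNIV = emeasure \<mu> ((\<lambda>x. x + a) ` F \<inter> range (\<lambda>x. x + a))"
      using G translate_borel[of UNIV a] \<open>sets \<mu> = sets borel\<close>
      by (subst emeasure_transl_measure)
        (simp_all add: emeasure_restr_measure, simp add: restr_measure_def)
    then show "emeasure ?L (space ?L) \<noteq> \<infinity>"
      using sets_eq_imp_space_eq[OF setsL] sp by simp
  qed
  then have "sigma_finite_measure ?L"
    by (rule finite_measure.axioms)
  then have ae: "AE x in \<mu>. ?h x \<noteq> \<infinity>"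
    by (rule RN_deriv_finite) (use assms setsL in auto)
  have [measurable]: "?h \<in> borel_measurable \<mu>" by simp
  have ae_eq: "AE x in \<mu>. ennreal (enn2real (?h x)) = ?h x"
    using ae by eventually_elim (auto simp: less_top)
  have "density \<mu> (\<lambda>x. ennreal (enn2real (?h x))) = density \<mu> ?h"
    using ae_eq by (intro density_cong) auto
  then have dens': "density \<mu> (\<lambda>x. ennreal (enn2real (?h x))) = ?L"
    by (simp only: dens)
  have "esssup \<mu> ?h \<le> ennreal c"
  proof (rule ccontr)
    assume "\<not> ?thesis"
    \<comment> \<open>An intermediate \<open>s\<close> is finite, being below another extended
      value, and lies strictly below the essential supremum, so it is exceeded on a set of positive
      measure.\<close>
    then obtain s where s: "ennreal c < s" "s < esssup \<mu> ?h"
      using dense[of "ennreal c"] by (auto simp: not_le)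
    then obtain t where t: "s = ennreal t" "0 \<le> t"
      by (cases s) (auto simp: top_unique)
    with s c have ct: "c < t" by (simp add: ennreal_less_iff)
    have "emeasure \<mu> {x \<in> space \<mu>. s < ?h x} > 0"
      by (rule esssup_pos_measure[OF _ s(2)]) simp
    also have "emeasure \<mu> {x \<in> space \<mu>. s < ?h x} = emeasure \<mu> {x \<in> space \<mu>. t < enn2real (?h x)}"
    proof (intro emeasure_eq_AE)
      show "AE x in \<mu>. x \<in> {x \<in> space \<mu>. s < ?h x} \<longleftrightarrow> x \<in> {x \<in> space \<mu>. t < enn2real (?h x)}"
        using ae_eq by eventually_elim (metis (mono_tags, lifting) ennreal_less_iff mem_Collect_eq t)
    qed simp_all
    finally have "t powr r \<le> B / A"
      unfolding r_def using c ct
      by (intro frame_measure_level_bound[OF assms(4-9) \<open>F \<in> sets borel\<close> _ _ dens']) (auto simp: sp)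
    \<comment> \<open>Strict monotonicity of the power contradicts
      \<open>t powr r \<le> B / A = c powr r\<close>.\<close>
    moreover have "c powr r < t powr r"
      using c ct r by (intro powr_less_mono2) auto
    ultimately show False using c by simp
  qed
  then show ?thesis
    using enn_powr_ennreal_le[of _ c r] c r by (simp add: r_def)
qed

end
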